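(* Let $(R,V)$ be a generalized root system with a fixed base $S$ and let $R^+=R^+(S)=\{\beta\in R:\beta=\sum_{\alpha\in S}m_\alpha\alpha\text{ with all }m_\alpha\in\mathbb{Z}_{\ge0}\}$ be the corresponding positive system, partially ordered by $\prec_S$. The poset $R^+$ is a lattice. Moreover, if $\beta'=\sum_{\alpha\in S}k'_\alpha\alpha$ and $\beta''=\sum_{\alpha\in S}k''_\alpha\alpha$ are elements of $R^+$, then $\beta'\wedge\beta''=\sum_{\alpha\in S}\min(k'_\alpha,k''_\alpha)\,\alpha$.
   Context: A generalized root system (GRS) is a pair $(R,V)$ where $V$ is a finite-dimensional Euclidean space and $R\subset V$ is a non-empty finite set such that: (i) $V=\operatorname{span} R$; (ii) for all $\alpha,\beta\in R$: if $\langle\alpha,\beta\rangle<0$ then $\alpha+\beta\in R$; if $\langle\alpha,\beta\rangle>0$ then $\alpha-\beta\in R$; if $\langle\alpha,\beta\rangle=0$ then $\alpha+\beta\in R$ if and only if $\alpha-\beta\in R$. (It follows that $0\in R$ and $R=-R$.) A base of $R$ is a subset $S\subset R$ which is a basis of $V$ and such that every $\beta\in R$ can be written $\beta=\sum_{\alpha\in S}m_\alpha\alpha$ with all $m_\alpha\in\mathbb{Z}_{\ge0}$ or all $m_\alpha\in\mathbb{Z}_{\le0}$. The partial order: $\lambda\prec_S\mu$ if $\mu-\lambda=\sum_{\alpha\in S}m_\alpha\alpha$ with $m_\alpha\in\mathbb{Z}_{\ge0}$ for every $\alpha\in S$. A partially ordered set (poset) is a lattice if any two elements $x,y$ have a supremum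 (join, denoted $x\vee y$) and an infimum (meet, denoted $x\wedge y$).
   Formalization: "R^+ is a lattice" is false for reducible R (e.g. A1×A1, where two orthogonal simple roots have no join); it is proved for irreducible R only, while existence of all meets and the min formula are proved for every generalized root system. *)

theory Defs
  imports "HOL-Analysis.Analysis" "HOL-Algebra.Lattice"
begin

text \<open>
  The Euclidean space \<open>V\<close> is a subspace of a type of class \<open>euclidean_space\<close>, so that
  \<open>V = {0}\<close> (with \<open>R = {0}\<close>) is not excluded.
\<close>

definition generalized_root_system :: "'a::euclidean_space set \<Rightarrow> 'a set \<Rightarrow> bool" where
  "generalized_root_system R V \<longleftrightarrow>
     R \<noteq> {} \<and> finite R \<and> V = span R \<and>
     (\<forall>\<alpha>\<in>R. \<forall>\<beta>\<in>R.
        (\<alpha> \<bullet> \<beta> < 0 \<longrightarrow> \<alpha> + \<beta> \<in> R) \<and>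
        (\<alpha> \<bullet> \<beta> > 0 \<longrightarrow> \<alpha> - \<beta> \<in> R) \<and>
        (\<alpha> \<bullet> \<beta> = 0 \<longrightarrow> (\<alpha> + \<beta> \<in> R \<longleftrightarrow> \<alpha> - \<beta> \<in> R)))"

text \<open>
  If \<open>R\<close> is a union of two mutually orthogonal subsets \<open>R'\<close>, \<open>R''\<close>, each containing a nonzero
  vector, then simple roots from different parts have no common upper bound in \<open>R\<^sup>+\<close>:
  \<open>A\<^sub>1 \<times> A\<^sub>1\<close> has \<open>R\<^sup>+ = {0, \<alpha>, \<beta>}\<close>. Hence irreducibility is needed for joins. For a generalized
  root system such a union is the same as a decomposition into two nonzero generalized root systems
  on complementary subspaces. The system \<open>R = {0}\<close> counts as irreducible.
\<close>

definition grs_irreducible :: "'a::euclidean_space set \<Rightarrow> bool" where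
  "grs_irreducible R \<longleftrightarrow>
     \<not> (\<exists>R' R''. R = R' \<union> R'' \<and> \<not> R' \<subseteq> {0} \<and> \<not> R'' \<subseteq> {0} \<and>
          (\<forall>\<alpha>\<in>R'. \<forall>\<beta>\<in>R''. \<alpha> \<bullet> \<beta> = 0))"

definition int_comb :: "'a::euclidean_space set \<Rightarrow> ('a \<Rightarrow> int) \<Rightarrow> 'a" where
  "int_comb S m = (\<Sum>\<alpha>\<in>S. of_int (m \<alpha>) *\<^sub>R \<alpha>)"

definition grs_base :: "'a::euclidean_space set \<Rightarrow> 'a set \<Rightarrow> 'a set \<Rightarrow> bool" where
  "grs_base R V S \<longleftrightarrow>
     S \<subseteq> R \<and> independent S \<and> span S = V \<and>
     (\<forall>\<beta>\<in>R. \<exists>m. \<beta> = int_comb S m \<and>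
        ((\<forall>\<alpha>\<in>S. 0 \<le> m \<alpha>) \<or> (\<forall>\<alpha>\<in>S. m \<alpha> \<le> 0)))"

definition positive_system :: "'a::euclidean_space set \<Rightarrow> 'a set \<Rightarrow> 'a set" where
  "positive_system R S = {\<beta> \<in> R. \<exists>m. \<beta> = int_comb S m \<and> (\<forall>\<alpha>\<in>S. 0 \<le> m \<alpha>)}"

definition grs_le :: "'a::euclidean_space set \<Rightarrow> 'a \<Rightarrow> 'a \<Rightarrow> bool" where
  "grs_le S x y \<longleftrightarrow> (\<exists>m. y - x = int_comb S m \<and> (\<forall>\<alpha>\<in>S. 0 \<le> m \<alpha>))"

definition positive_poset :: "'a::euclidean_space set \<Rightarrow> 'a set \<Rightarrow> 'a gorder" where
  "positive_poset R S = \<lparr>carrier = positive_system R S, eq = (=), le = grs_le S\<rparr>"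

end

theory Submission
  imports Defs
begin

text \<open>
  Everything is read off from integer coordinates with respect to the base \<open>S\<close>. The two facts about
  \<open>S\<close> that matter are that distinct elements of \<open>S\<close> have nonpositive inner product (their
  difference has mixed signs, so it is no root) and that a root never has coordinates of both signs.

  \<^emph>\<open>Meets.\<close> Let \<open>\<mu>\<close> be the coordinatewise minimum of two positive roots \<open>\<mu> + x\<close> and \<open>\<mu> + y\<close>, so
  that \<open>x\<close> and \<open>y\<close> have disjoint supports. If some \<open>\<alpha> \<in> S\<close> in the support of \<open>x\<close> satisfies
  \<open>(\<mu> + x) \<bullet> \<alpha> > 0\<close>, then \<open>\<mu> + x - \<alpha>\<close> is again a positive root and \<open>\<mu>\<close> is still the minimum; the
  same holds with \<open>y\<close> in place of \<open>x\<close>. Such steps cannot get stuck before \<open>x = 0\<close> or \<open>y = 0\<close>: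
  when neither is possible, \<open>(\<mu> + x) \<bullet> x \<le> 0\<close> and \<open>(\<mu> + y) \<bullet> y \<le> 0\<close>, while \<open>x \<bullet> y \<le> 0\<close> by
  disjointness and \<open>(\<mu> + x) \<bullet> (\<mu> + y) \<le> 0\<close> because the difference \<open>x - y\<close> has mixed signs. The sum
  of these four numbers is \<open>(\<mu> + x + y) \<bullet> (\<mu> + x + y)\<close>, so \<open>\<mu> + x + y = 0\<close>, and as all
  coordinates are nonnegative, \<open>x = y = 0\<close>. So \<open>\<mu>\<close> is itself a root, and it is then clearly the meet
  (lemma \<open>root_coord_min\<close>).

  \<^emph>\<open>Joins.\<close> In a finite meet semilattice, two elements with a common upper bound have a join,
  namely the meet of all their upper bounds. So it suffices that \<open>R\<^sup>+\<close> has a unique maximal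
  element when \<open>R\<close> is irreducible. A maximal element has nonnegative inner product with every
  simple root. For two distinct maximal elements this forces their supports to be orthogonal to
  each other (lemma \<open>dominant_incomparable_supports_orthogonal\<close>). As every positive root lies below
  a maximal one, the roots supported in the support of one maximal element are then
  orthogonal to all the others, and \<open>R\<close> is reducible.
\<close>

section \<open>Integer combinations\<close>

lemma int_comb_cong:
  "(\<And>\<alpha>. \<alpha> \<in> S \<Longrightarrow> k \<alpha> = l \<alpha>) \<Longrightarrow> int_comb S k = int_comb S l"
  by (simp add: int_comb_def)

lemma int_comb_add: "int_comb S (\<lambda>\<alpha>. k \<alpha> + l \<alpha>) = int_comb S k + int_comb S l"
  by (simp add: int_comb_def scaleR_left_distrib sum.distrib)

lemma int_comb_diff: "int_comb S (\<lambda>\<alpha>. k \<alpha> - l \<alpha>) = int_comb S k - int_comb S l"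
  by (simp add: int_comb_def scaleR_left_diff_distrib sum_subtractf)

lemma int_comb_uminus: "int_comb S (\<lambda>\<alpha>. - k \<alpha>) = - int_comb S k"
  by (simp add: int_comb_def sum_negf)

lemma int_comb_fun_upd:
  assumes "finite S" "\<alpha> \<in> S"
  shows "int_comb S (k(\<alpha> := k \<alpha> + c)) = int_comb S k + of_int c *\<^sub>R \<alpha>"
  using assms by (simp add: int_comb_def sum.remove[of S \<alpha>] scaleR_left_distrib)

lemma int_comb_inner_left: "int_comb S k \<bullet> v = (\<Sum>\<alpha>\<in>S. of_int (k \<alpha>) * (\<alpha> \<bullet> v))"
  by (simp add: int_comb_def inner_sum_left)

lemma int_comb_inner_right: "v \<bullet> int_comb S k = (\<Sum>\<alpha>\<in>S. of_int (k \<alpha>) * (v \<bullet> \<alpha>))"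
  by (simp add: int_comb_def inner_sum_right)

section \<open>A generalized root system with a base\<close>

locale based_grs =
  fixes R V S :: "'a::euclidean_space set"
  assumes grs: "generalized_root_system R V"
    and base: "grs_base R V S"
begin

abbreviation comb :: "('a \<Rightarrow> int) \<Rightarrow> 'a" where "comb \<equiv> int_comb S"

lemma finite_R: "finite R"
  using grs by (simp add: generalized_root_system_def)

lemma finite_S: "finite S"
  using base finite_R by (auto simp: grs_base_def intro: finite_subset)

lemma sum_root: "\<alpha> \<in> R \<Longrightarrow> \<beta> \<in> R \<Longrightarrow> \<alpha> \<bullet> \<beta> < 0 \<Longrightarrow> \<alpha> + \<beta> \<in> R"
  and diff_root: "\<alpha> \<in> R \<Longrightarrow> \<beta> \<in> R \<Longrightarrow> \<alpha> \<bullet> \<beta> > 0 \<Longrightarrow> \<alpha> - \<beta> \<in> R"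
  using grs by (auto simp: generalized_root_system_def)

lemma zero_root: "0 \<in> R"
proof -
  obtain \<alpha> where "\<alpha> \<in> R"
    using grs by (auto simp: generalized_root_system_def)
  then show ?thesis
    using diff_root[of \<alpha> \<alpha>] by (cases "\<alpha> = 0") auto
qed

lemma uminus_root:
  assumes "\<alpha> \<in> R"
  shows "- \<alpha> \<in> R"
proof -
  have "0 \<bullet> \<alpha> = 0 \<longrightarrow> (0 + \<alpha> \<in> R \<longleftrightarrow> 0 - \<alpha> \<in> R)"
    using grs zero_root assms unfolding generalized_root_system_def by blast
  then show ?thesis
    using assms by simp
qed

lemma comb_eq_iff: "comb k = comb l \<longleftrightarrow> (\<forall>\<alpha>\<in>S. k \<alpha> = l \<alpha>)"
proof
  assume "comb k = comb l"
  then have "(\<Sum>\<alpha>\<in>S. of_int (k \<alpha> - l \<alpha>) *\<^sub>R \<alpha>) = 0"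
    using int_comb_diff[of S k l] by (simp add: int_comb_def)
  moreover have "independent S"
    using base by (simp add: grs_base_def)
  ultimately have "real_of_int (k \<alpha> - l \<alpha>) = 0" if "\<alpha> \<in> S" for \<alpha>
    using independentD[of S S "\<lambda>\<alpha>. of_int (k \<alpha> - l \<alpha>)" \<alpha>] finite_S that by auto
  then show "\<forall>\<alpha>\<in>S. k \<alpha> = l \<alpha>"
    by force
qed (auto intro: int_comb_cong)

lemma comb_eq_0_iff: "comb k = 0 \<longleftrightarrow> (\<forall>\<alpha>\<in>S. k \<alpha> = 0)"
  using comb_eq_iff[of k "\<lambda>_. 0"] by (simp add: int_comb_def)

lemma root_coords:
  assumes "\<beta> \<in> R"
  obtains k where "\<beta> = comb k" "(\<forall>\<alpha>\<in>S. 0 \<le> k \<alpha>) \<or> (\<forall>\<alpha>\<in>S. k \<alpha> \<le> 0)"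
  using assms base unfolding grs_base_def by blast

lemma root_coords_same_sign:
  assumes "comb k \<in> R"
  shows "(\<forall>\<alpha>\<in>S. 0 \<le> k \<alpha>) \<or> (\<forall>\<alpha>\<in>S. k \<alpha> \<le> 0)"
  using root_coords[OF assms] by (metis comb_eq_iff)

lemma simple_root_nonzero: "\<alpha> \<in> S \<Longrightarrow> \<alpha> \<noteq> 0"
  using base dependent_zero by (auto simp: grs_base_def)

lemma simple_root_in_R: "\<alpha> \<in> S \<Longrightarrow> \<alpha> \<in> R"
  using base by (auto simp: grs_base_def)

text \<open>The difference of two distinct simple roots has coordinates of both signs.\<close>

lemma simple_roots_obtuse:
  assumes "\<alpha> \<in> S" "\<beta> \<in> S" "\<alpha> \<noteq> \<beta>"
  shows "\<alpha> \<bullet> \<beta> \<le> 0"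
proof (rule ccontr)
  define k where "k = (\<lambda>_. 0::int)(\<alpha> := 1, \<beta> := -1)"
  assume "\<not> \<alpha> \<bullet> \<beta> \<le> 0"
  then have "\<alpha> - \<beta> \<in> R"
    using assms simple_root_in_R diff_root by auto
  moreover have "comb k = \<alpha> - \<beta>"
    using assms finite_S int_comb_fun_upd[of S \<alpha> "\<lambda>_. 0" 1]
      int_comb_fun_upd[of S \<beta> "(\<lambda>_. 0)(\<alpha> := 1)" "-1"]
    by (simp add: k_def int_comb_def[of S "\<lambda>_. 0"])
  ultimately show False
    using root_coords_same_sign[of k] assms by (auto simp: k_def)
qed

lemma disjoint_supports_obtuse:
  assumes "\<forall>\<alpha>\<in>S. 0 \<le> k \<alpha>" "\<forall>\<alpha>\<in>S. 0 \<le> l \<alpha>" "\<forall>\<alpha>\<in>S. k \<alpha> = 0 \<or> l \<alpha> = 0"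
  shows "comb k \<bullet> comb l \<le> 0"
proof -
  have "real_of_int (l \<beta>) * (real_of_int (k \<alpha>) * (\<alpha> \<bullet> \<beta>)) \<le> 0"
    if "\<alpha> \<in> S" "\<beta> \<in> S" for \<alpha> \<beta>
  proof (cases "\<alpha> = \<beta>")
    case False
    then show ?thesis
      using that assms simple_roots_obtuse[of \<alpha> \<beta>] by (simp add: mult_nonneg_nonpos)
  qed (use that assms in auto)
  then show ?thesis
    by (auto simp: int_comb_inner_left int_comb_inner_right sum_distrib_left intro!: sum_nonpos)
qed

section \<open>Coordinatewise minima of positive roots\<close>

text \<open>
  If neither positive root can be shortened by a simple root in which it exceeds the other, then
  the obtuse angles leave no room for the two to be incomparable.
\<close>

lemma incomparable_roots_shortenable:
  assumes k: "comb k \<in> R" "\<forall>\<alpha>\<in>S. 0 \<le> k \<alpha>" and l: "comb l \<in> R" "\<forall>\<alpha>\<in>S. 0 \<le> l \<alpha>"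
    and incomparable: "\<exists>\<alpha>\<in>S. l \<alpha> < k \<alpha>" "\<exists>\<alpha>\<in>S. k \<alpha> < l \<alpha>"
  shows "(\<exists>\<alpha>\<in>S. l \<alpha> < k \<alpha> \<and> comb k \<bullet> \<alpha> > 0) \<or> (\<exists>\<alpha>\<in>S. k \<alpha> < l \<alpha> \<and> comb l \<bullet> \<alpha> > 0)"
proof (rule ccontr)
  assume "\<not> ?thesis"
  then have stuck: "\<And>\<alpha>. \<alpha> \<in> S \<Longrightarrow> l \<alpha> < k \<alpha> \<Longrightarrow> comb k \<bullet> \<alpha> \<le> 0"
    "\<And>\<alpha>. \<alpha> \<in> S \<Longrightarrow> k \<alpha> < l \<alpha> \<Longrightarrow> comb l \<bullet> \<alpha> \<le> 0"
    by (auto simp: not_less)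
  define m where "m = (\<lambda>\<alpha>. min (k \<alpha>) (l \<alpha>))"
  define x where "x = (\<lambda>\<alpha>. k \<alpha> - m \<alpha>)"
  define y where "y = (\<lambda>\<alpha>. l \<alpha> - m \<alpha>)"
  have k_eq: "comb k = comb m + comb x" and l_eq: "comb l = comb m + comb y"
    by (simp_all add: x_def y_def int_comb_diff)
  have "of_int (x \<alpha>) * (comb k \<bullet> \<alpha>) \<le> 0" "of_int (y \<alpha>) * (comb l \<bullet> \<alpha>) \<le> 0" if "\<alpha> \<in> S" for \<alpha>
    using stuck[OF that] by (cases "k \<alpha>" "l \<alpha>" rule: linorder_cases;
        simp add: x_def y_def m_def mult_nonneg_nonpos)+
  then have "comb k \<bullet> comb x \<le> 0" "comb l \<bullet> comb y \<le> 0"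
    by (simp_all add: int_comb_inner_right[of "comb k"] int_comb_inner_right[of "comb l"] sum_nonpos)
  moreover have "comb x \<bullet> comb y \<le> 0"
    by (rule disjoint_supports_obtuse) (auto simp: x_def y_def m_def min_def)
  moreover have "comb k \<bullet> comb l \<le> 0"
  proof (rule ccontr)
    assume "\<not> comb k \<bullet> comb l \<le> 0"
    then have "comb (\<lambda>\<alpha>. k \<alpha> - l \<alpha>) \<in> R"
      using k l diff_root by (simp add: int_comb_diff)
    then show False
      using root_coords_same_sign incomparable by force
  qed
  moreover have "(comb m + comb x + comb y) \<bullet> (comb m + comb x + comb y)
      = comb k \<bullet> comb l + comb k \<bullet> comb x + comb l \<bullet> comb y + comb x \<bullet> comb y"
    by (simp add: k_eq l_eq inner_simps inner_commute)
  ultimately have "(comb m + comb x + comb y) \<bullet> (comb m + comb x + comb y) \<le> 0"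
    by linarith
  then have "comb m + comb x + comb y = 0"
    by (metis inner_eq_zero_iff inner_ge_zero order_antisym)
  then have "comb (\<lambda>\<alpha>. m \<alpha> + x \<alpha> + y \<alpha>) = 0"
    by (simp add: int_comb_add)
  then have "\<forall>\<alpha>\<in>S. k \<alpha> + l \<alpha> - m \<alpha> = 0"
    unfolding comb_eq_0_iff by (simp add: x_def y_def algebra_simps)
  then show False
    using incomparable k l by (force simp: m_def min_def)
qed

text \<open>
  By induction on the total difference of the coordinates: while the roots are incomparable, one of
  them can be shortened without changing the minimum.
\<close>

lemma root_coord_min:
  assumes "comb k \<in> R" "\<forall>\<alpha>\<in>S. 0 \<le> k \<alpha>" "comb l \<in> R" "\<forall>\<alpha>\<in>S. 0 \<le> l \<alpha>"
  shows "comb (\<lambda>\<alpha>. min (k \<alpha>) (l \<alpha>)) \<in> R"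
  using assms
proof (induction "\<Sum>\<alpha>\<in>S. nat \<bar>k \<alpha> - l \<alpha>\<bar>" arbitrary: k l rule: less_induct)
  case less
  \<comment> \<open>The step is stated for an arbitrary pair, so that it serves for shortening either root.\<close>
  have step: "comb (\<lambda>\<beta>. min (p \<beta>) (q \<beta>)) \<in> R"
    if p: "comb p \<in> R" "\<forall>\<beta>\<in>S. 0 \<le> p \<beta>" and q: "comb q \<in> R" "\<forall>\<beta>\<in>S. 0 \<le> q \<beta>"
      and \<alpha>: "\<alpha> \<in> S" "q \<alpha> < p \<alpha>" "comb p \<bullet> \<alpha> > 0"
      and eq: "(\<Sum>\<beta>\<in>S. nat \<bar>p \<beta> - q \<beta>\<bar>) = (\<Sum>\<beta>\<in>S. nat \<bar>k \<beta> - l \<beta>\<bar>)"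
    for p q \<alpha>
  proof -
    define p' where "p' = p(\<alpha> := p \<alpha> + -1)"
    have "comb p' = comb p - \<alpha>"
      unfolding p'_def by (subst int_comb_fun_upd) (use \<alpha> finite_S in auto)
    then have "comb p' \<in> R"
      using diff_root[OF p(1) simple_root_in_R] \<alpha> by simp
    moreover have "\<forall>\<beta>\<in>S. 0 \<le> p' \<beta>"
      using p(2) q(2) \<alpha> by (force simp: p'_def)
    moreover have "(\<Sum>\<beta>\<in>S. nat \<bar>p' \<beta> - q \<beta>\<bar>) < (\<Sum>\<beta>\<in>S. nat \<bar>p \<beta> - q \<beta>\<bar>)"
      using \<alpha> finite_S by (intro sum_strict_mono_ex1) (auto simp: p'_def)
    ultimately have "comb (\<lambda>\<beta>. min (p' \<beta>) (q \<beta>)) \<in> R"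
      using less.hyps q eq by simp
    moreover have "(\<lambda>\<beta>. min (p' \<beta>) (q \<beta>)) = (\<lambda>\<beta>. min (p \<beta>) (q \<beta>))"
      using \<alpha> by (auto simp: p'_def fun_eq_iff)
    ultimately show ?thesis
      by simp
  qed
  consider "\<forall>\<alpha>\<in>S. k \<alpha> \<le> l \<alpha>" | "\<forall>\<alpha>\<in>S. l \<alpha> \<le> k \<alpha>"
    | \<alpha> where "\<alpha> \<in> S" "l \<alpha> < k \<alpha>" "comb k \<bullet> \<alpha> > 0"
    | \<alpha> where "\<alpha> \<in> S" "k \<alpha> < l \<alpha>" "comb l \<bullet> \<alpha> > 0"
    using incomparable_roots_shortenable[OF less.prems] by (meson not_le)
  then show ?case
  proof cases
    case 1
    then have "comb (\<lambda>\<alpha>. min (k \<alpha>) (l \<alpha>)) = comb k"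
      by (intro int_comb_cong) auto
    then show ?thesis
      using less.prems by simp
  next
    case 2
    then have "comb (\<lambda>\<alpha>. min (k \<alpha>) (l \<alpha>)) = comb l"
      by (intro int_comb_cong) auto
    then show ?thesis
      using less.prems by simp
  next
    case 3
    then show ?thesis
      using step[of k l] less.prems by simp
  next
    case 4
    then have "comb (\<lambda>\<alpha>. min (l \<alpha>) (k \<alpha>)) \<in> R"
      using step[of l k] less.prems by (simp add: abs_minus_commute)
    then show ?thesis
      by (simp add: min.commute)
  qed
qed

section \<open>The poset of positive roots\<close>

lemma comb_in_positive_system_iff:
  "comb k \<in> positive_system R S \<longleftrightarrow> comb k \<in> R \<and> (\<forall>\<alpha>\<in>S. 0 \<le> k \<alpha>)"
  unfolding positive_system_def by (auto simp: comb_eq_iff)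

lemma positive_system_coords:
  assumes "\<beta> \<in> positive_system R S"
  obtains k where "\<beta> = comb k" "comb k \<in> R" "\<forall>\<alpha>\<in>S. 0 \<le> k \<alpha>"
  using assms unfolding positive_system_def by auto

lemma grs_le_comb_iff: "grs_le S (comb k) (comb l) \<longleftrightarrow> (\<forall>\<alpha>\<in>S. k \<alpha> \<le> l \<alpha>)"
  unfolding grs_le_def int_comb_diff[symmetric] comb_eq_iff
  by (auto intro!: exI[of _ "\<lambda>\<alpha>. l \<alpha> - k \<alpha>"]) force

lemma positive_poset_partial_order: "partial_order (positive_poset R S)"
proof
  fix x y z
  show "x .=\<^bsub>positive_poset R S\<^esub> z"
    if "x .=\<^bsub>positive_poset R S\<^esub> y" "y .=\<^bsub>positive_poset R S\<^esub> z"
    using that by (simp add: positive_poset_def)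
  show "x .=\<^bsub>positive_poset R S\<^esub> y"
    if "x \<sqsubseteq>\<^bsub>positive_poset R S\<^esub> y" "y \<sqsubseteq>\<^bsub>positive_poset R S\<^esub> x"
      "x \<in> carrier (positive_poset R S)" "y \<in> carrier (positive_poset R S)"
    using that
    by (auto simp: positive_poset_def grs_le_comb_iff comb_eq_iff order.eq_iff
        elim!: positive_system_coords)
  show "x \<sqsubseteq>\<^bsub>positive_poset R S\<^esub> z"
    if "x \<sqsubseteq>\<^bsub>positive_poset R S\<^esub> y" "y \<sqsubseteq>\<^bsub>positive_poset R S\<^esub> z"
      "x \<in> carrier (positive_poset R S)" "y \<in> carrier (positive_poset R S)"
      "z \<in> carrier (positive_poset R S)"
    using that
    by (force simp: positive_poset_def grs_le_comb_iff elim!: positive_system_coords)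
qed (auto simp: positive_poset_def grs_le_comb_iff elim!: positive_system_coords)

lemma coord_min_is_glb:
  assumes "comb k \<in> positive_system R S" "comb l \<in> positive_system R S"
  shows "is_glb (positive_poset R S) (comb (\<lambda>\<alpha>. min (k \<alpha>) (l \<alpha>))) {comb k, comb l}"
  using assms root_coord_min[of k l]
  by (auto simp: greatest_def Lower_def positive_poset_def comb_in_positive_system_iff
      grs_le_comb_iff elim!: positive_system_coords)

lemma positive_poset_lower_semilattice: "lower_semilattice (positive_poset R S)"
proof -
  interpret partial_order "positive_poset R S"
    by (rule positive_poset_partial_order)
  show ?thesis
  proof
    fix x y
    assume "x \<in> carrier (positive_poset R S)" "y \<in> carrier (positive_poset R S)"
    then have xy: "x \<in> positive_system R S" "y \<in> positive_system R S"
      by (simp_all add: positive_poset_def)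
    obtain k l where "x = comb k" "y = comb l"
      using xy[THEN positive_system_coords] by metis
    then show "\<exists>s. is_glb (positive_poset R S) s {x, y}"
      using coord_min_is_glb xy by blast
  qed
qed

lemma meet_eq_coord_min:
  assumes "comb k \<in> positive_system R S" "comb l \<in> positive_system R S"
  shows "comb k \<sqinter>\<^bsub>positive_poset R S\<^esub> comb l = comb (\<lambda>\<alpha>. min (k \<alpha>) (l \<alpha>))"
proof -
  interpret lower_semilattice "positive_poset R S"
    by (rule positive_poset_lower_semilattice)
  show ?thesis
  proof (rule meetI)
    fix i
    assume "is_glb (positive_poset R S) i {comb k, comb l}"
    then have "i .=\<^bsub>positive_poset R S\<^esub> comb (\<lambda>\<alpha>. min (k \<alpha>) (l \<alpha>))"
      using coord_min_is_glb[OF assms] by (rule weak_greatest_unique)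
    then show "i = comb (\<lambda>\<alpha>. min (k \<alpha>) (l \<alpha>))"
      by (simp add: positive_poset_def)
  qed (use assms in \<open>simp_all add: positive_poset_def\<close>)
qed

section \<open>Maximal positive roots\<close>

definition maximal_coords :: "('a \<Rightarrow> int) \<Rightarrow> bool" where
  "maximal_coords k \<longleftrightarrow> comb k \<in> R \<and> (\<forall>\<alpha>\<in>S. 0 \<le> k \<alpha>) \<and>
     (\<forall>l. comb l \<in> R \<longrightarrow> (\<forall>\<alpha>\<in>S. k \<alpha> \<le> l \<alpha>) \<longrightarrow> (\<forall>\<alpha>\<in>S. l \<alpha> = k \<alpha>))"

lemma below_maximal_coords:
  assumes "comb k \<in> R" "\<forall>\<alpha>\<in>S. 0 \<le> k \<alpha>"
  obtains h where "maximal_coords h" "\<forall>\<alpha>\<in>S. k \<alpha> \<le> h \<alpha>"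
proof -
  \<comment> \<open>Coordinate functions are only determined on \<open>S\<close>; extending them by \<open>0\<close> makes the roots
    correspond to a finite set of functions with the pointwise order.\<close>
  define ext where "ext = (\<lambda>l \<alpha>. if \<alpha> \<in> S then l \<alpha> else (0::int))"
  define A where "A = {l. comb l \<in> R \<and> ext l = l}"
  have ext: "comb (ext l) = comb l" for l
    by (rule int_comb_cong) (simp add: ext_def)
  have "inj_on comb A"
  proof (rule inj_onI)
    fix l l'
    assume "l \<in> A" "l' \<in> A" "comb l = comb l'"
    moreover from this have "ext l = ext l'"
      by (auto simp: ext_def comb_eq_iff)
    ultimately show "l = l'"
      by (simp add: A_def)
  qed
  moreover have "comb ` A \<subseteq> R"
    by (auto simp: A_def)
  ultimately have "finite A"
    using finite_R by (rule inj_on_finite)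
  moreover have ext_A: "ext l \<in> A" if "comb l \<in> R" for l
  proof -
    have "ext (ext l) = ext l"
      by (simp add: ext_def fun_eq_iff)
    then show ?thesis
      using that by (simp add: A_def ext)
  qed
  ultimately obtain h where h: "h \<in> A" "ext k \<le> h" "\<forall>l\<in>A. h \<le> l \<longrightarrow> h = l"
    using finite_has_maximal2[of A "ext k"] assms(1) by blast
  have above: "\<forall>\<alpha>\<in>S. k \<alpha> \<le> h \<alpha>"
    using h(2) by (auto simp: le_fun_def ext_def split: if_splits)
  then have "\<forall>\<alpha>\<in>S. 0 \<le> h \<alpha>"
    using assms(2) by (meson order_trans)
  moreover have "\<forall>\<alpha>\<in>S. l \<alpha> = h \<alpha>" if "comb l \<in> R" "\<forall>\<alpha>\<in>S. h \<alpha> \<le> l \<alpha>" for l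
  proof -
    have "ext h \<le> ext l"
      using that(2) by (auto simp: le_fun_def ext_def)
    then have "h = ext l"
      using h ext_A[OF that(1)] by (simp add: A_def)
    then show ?thesis
      by (simp add: ext_def)
  qed
  ultimately have "maximal_coords h"
    using h(1) unfolding maximal_coords_def A_def mem_Collect_eq by blast
  then show thesis
    using above that by blast
qed

lemma maximal_coords_dominant:
  assumes "maximal_coords k" "\<alpha> \<in> S"
  shows "comb k \<bullet> \<alpha> \<ge> 0"
proof (rule ccontr)
  assume "\<not> comb k \<bullet> \<alpha> \<ge> 0"
  then have "comb (k(\<alpha> := k \<alpha> + 1)) \<in> R"
    using assms sum_root[of "comb k" \<alpha>] simple_root_in_R
    by (subst int_comb_fun_upd) (auto simp: finite_S maximal_coords_def)
  moreover have "\<forall>\<beta>\<in>S. k \<beta> \<le> (k(\<alpha> := k \<alpha> + 1)) \<beta>"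
    by simp
  ultimately have "(k(\<alpha> := k \<alpha> + 1)) \<alpha> = k \<alpha>"
    using assms unfolding maximal_coords_def by blast
  then show False
    by simp
qed

text \<open>
  Write the roots as \<open>\<mu> + x\<close> and \<open>\<mu> + y\<close> with \<open>\<mu>\<close> their coordinatewise minimum. Incomparability
  gives \<open>(\<mu> + x) \<bullet> (\<mu> + y) \<le> 0\<close>, and dominance makes this inner product a sum of nonnegative
  terms. So each root is orthogonal to the support of the other, which yields \<open>\<mu> \<bullet> \<mu> = x \<bullet> y \<le> 0\<close>
  and \<open>\<mu> = 0\<close>. For \<open>\<alpha>\<close> in the support of the first root, \<open>\<alpha> \<bullet> (\<mu> + y) = 0\<close> is now a sum
  of nonpositive terms.
\<close>

lemma dominant_incomparable_supports_orthogonal: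
  assumes k: "comb k \<in> R" "\<forall>\<alpha>\<in>S. 0 \<le> k \<alpha>" "\<forall>\<alpha>\<in>S. comb k \<bullet> \<alpha> \<ge> 0"
    and l: "comb l \<in> R" "\<forall>\<alpha>\<in>S. 0 \<le> l \<alpha>" "\<forall>\<alpha>\<in>S. comb l \<bullet> \<alpha> \<ge> 0"
    and incomparable: "\<exists>\<alpha>\<in>S. l \<alpha> < k \<alpha>" "\<exists>\<alpha>\<in>S. k \<alpha> < l \<alpha>"
    and \<alpha>: "\<alpha> \<in> S" "k \<alpha> \<noteq> 0" and \<beta>: "\<beta> \<in> S" "l \<beta> \<noteq> 0"
  shows "\<alpha> \<bullet> \<beta> = 0"
proof -
  have le0: "comb k \<bullet> comb l \<le> 0"
  proof (rule ccontr)
    assume "\<not> comb k \<bullet> comb l \<le> 0"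
    then have "comb (\<lambda>\<alpha>. k \<alpha> - l \<alpha>) \<in> R"
      using k l diff_root by (simp add: int_comb_diff)
    then show False
      using root_coords_same_sign incomparable by force
  qed
  \<comment> \<open>A vanishing sum of nonnegative terms vanishes termwise. This is used for both orders of the
    two roots.\<close>
  have orth: "q \<gamma> = 0 \<or> comb p \<bullet> \<gamma> = 0"
    if "\<forall>\<alpha>\<in>S. comb p \<bullet> \<alpha> \<ge> 0" "\<forall>\<alpha>\<in>S. 0 \<le> q \<alpha>" "comb p \<bullet> comb q \<le> 0" "\<gamma> \<in> S" for p q \<gamma>
  proof -
    have "\<forall>\<alpha>\<in>S. of_int (q \<alpha>) * (comb p \<bullet> \<alpha>) \<ge> 0"
      using that by simp
    moreover from this have "(\<Sum>\<alpha>\<in>S. of_int (q \<alpha>) * (comb p \<bullet> \<alpha>)) = 0"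
      using that(3) sum_nonneg[of S "\<lambda>\<alpha>. of_int (q \<alpha>) * (comb p \<bullet> \<alpha>)"]
      unfolding int_comb_inner_right[of "comb p"] by force
    ultimately have "of_int (q \<gamma>) * (comb p \<bullet> \<gamma>) = 0"
      using sum_nonneg_eq_0_iff[OF finite_S, of "\<lambda>\<alpha>. of_int (q \<alpha>) * (comb p \<bullet> \<alpha>)"] that(4) by blast
    then show ?thesis
      by simp
  qed
  have kl: "l \<gamma> = 0 \<or> comb k \<bullet> \<gamma> = 0" and lk: "k \<gamma> = 0 \<or> comb l \<bullet> \<gamma> = 0" if "\<gamma> \<in> S" for \<gamma>
    using orth[of k l \<gamma>] orth[of l k \<gamma>] k l le0 that by (auto simp: inner_commute)
  define m where "m = (\<lambda>\<alpha>. min (k \<alpha>) (l \<alpha>))"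
  define x where "x = (\<lambda>\<alpha>. k \<alpha> - m \<alpha>)"
  define y where "y = (\<lambda>\<alpha>. l \<alpha> - m \<alpha>)"
  have k_eq: "comb k = comb m + comb x" and l_eq: "comb l = comb m + comb y"
    by (simp_all add: x_def y_def int_comb_diff)
  \<comment> \<open>The coordinates \<open>m\<close> and \<open>y\<close> vanish wherever \<open>l\<close> does.\<close>
  have "comb k \<bullet> comb m = 0" "comb k \<bullet> comb y = 0"
    unfolding int_comb_inner_right[of "comb k"] using kl k(2) l(2)
    by (force simp: m_def y_def min_def intro!: sum.neutral)+
  moreover have "comb l \<bullet> comb x = 0"
    unfolding int_comb_inner_right[of "comb l"] using lk k(2) l(2)
    by (force simp: m_def x_def min_def intro!: sum.neutral)
  moreover have "comb x \<bullet> comb y \<le> 0"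
    by (rule disjoint_supports_obtuse) (auto simp: x_def y_def m_def min_def)
  ultimately have "comb m \<bullet> comb m \<le> 0"
    by (simp add: k_eq l_eq inner_simps inner_commute)
  then have "comb m = 0"
    by (metis inner_eq_zero_iff inner_ge_zero order_antisym)
  then have disjoint: "k \<gamma> = 0 \<or> l \<gamma> = 0" if "\<gamma> \<in> S" for \<gamma>
    using that unfolding comb_eq_0_iff by (auto simp: m_def min_def split: if_splits)
  have "- (of_int (l \<gamma>) * (\<alpha> \<bullet> \<gamma>)) \<ge> 0" if "\<gamma> \<in> S" for \<gamma>
    using that disjoint[OF \<alpha>(1)] \<alpha> l(2) simple_roots_obtuse[of \<alpha> \<gamma>]
    by (cases "\<gamma> = \<alpha>") (auto simp: mult_nonneg_nonpos)
  moreover have "(\<Sum>\<gamma>\<in>S. - (of_int (l \<gamma>) * (\<alpha> \<bullet> \<gamma>))) = 0"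
    using lk[OF \<alpha>(1)] \<alpha>(2) int_comb_inner_right[of \<alpha> S l]
    by (simp add: sum_negf inner_commute[of \<alpha> "comb l"])
  ultimately have "- (of_int (l \<beta>) * (\<alpha> \<bullet> \<beta>)) = 0"
    using sum_nonneg_eq_0_iff[OF finite_S, of "\<lambda>\<gamma>. - (of_int (l \<gamma>) * (\<alpha> \<bullet> \<gamma>))"] \<beta>(1) by blast
  then show ?thesis
    using \<beta>(2) by simp
qed

lemma maximal_coords_supports_orthogonal:
  assumes "maximal_coords k" "maximal_coords l" "\<exists>\<gamma>\<in>S. k \<gamma> \<noteq> l \<gamma>"
    and "\<alpha> \<in> S" "k \<alpha> \<noteq> 0" "\<beta> \<in> S" "l \<beta> \<noteq> 0"
  shows "\<alpha> \<bullet> \<beta> = 0"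
proof (rule dominant_incomparable_supports_orthogonal[of k l])
  show "\<exists>\<gamma>\<in>S. l \<gamma> < k \<gamma>" "\<exists>\<gamma>\<in>S. k \<gamma> < l \<gamma>"
    using assms(1-3) unfolding maximal_coords_def by (metis not_le)+
qed (use assms maximal_coords_dominant in \<open>auto simp: maximal_coords_def\<close>)

text \<open>
  A second maximal root would split \<open>R\<close> into the roots \<open>R1\<close> supported in the support of \<open>k\<close> and the
  rest: up to sign, a root of the rest lies below a maximal root other than \<open>comb k\<close>, so its support
  is orthogonal to that of \<open>k\<close>.
\<close>

lemma irreducible_maximal_coords_unique:
  assumes "grs_irreducible R" and k: "maximal_coords k" and l: "maximal_coords l"
  shows "\<forall>\<alpha>\<in>S. k \<alpha> = l \<alpha>"
proof (rule ccontr)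
  assume "\<not> ?thesis"
  then have distinct: "\<exists>\<alpha>\<in>S. k \<alpha> \<noteq> l \<alpha>"
    by blast
  define R1 where "R1 = {\<beta> \<in> R. \<exists>n. \<beta> = comb n \<and> (\<forall>\<alpha>\<in>S. n \<alpha> \<noteq> 0 \<longrightarrow> k \<alpha> \<noteq> 0)}"
  \<comment> \<open>As \<open>0\<close> lies below every positive root, it is maximal only if it is the only one.\<close>
  have nonzero: "comb p \<noteq> 0"
    if p: "maximal_coords p" and q: "maximal_coords q" "\<exists>\<alpha>\<in>S. p \<alpha> \<noteq> q \<alpha>" for p q
  proof
    assume "comb p = 0"
    then have "\<forall>\<alpha>\<in>S. p \<alpha> \<le> q \<alpha>"
      using q(1) by (simp add: comb_eq_0_iff maximal_coords_def)
    then have "\<forall>\<alpha>\<in>S. q \<alpha> = p \<alpha>"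
      using p q(1) by (simp add: maximal_coords_def)
    then show False
      using q(2) by simp
  qed
  have nonzero: "comb k \<noteq> 0" "comb l \<noteq> 0"
    using nonzero[OF k l distinct] nonzero[OF l k] distinct by metis+
  have "comb k \<in> R1"
    using k by (auto simp: R1_def maximal_coords_def)
  moreover have "comb l \<in> R - R1"
  proof -
    obtain \<alpha> where "\<alpha> \<in> S" "l \<alpha> \<noteq> 0"
      using nonzero(2) comb_eq_0_iff by blast
    then have "k \<alpha> = 0"
      using maximal_coords_supports_orthogonal[OF k l distinct, of \<alpha> \<alpha>] simple_root_nonzero by auto
    then have "comb l \<notin> R1"
      using \<open>\<alpha> \<in> S\<close> \<open>l \<alpha> \<noteq> 0\<close> unfolding R1_def mem_Collect_eq comb_eq_iff by metis
    then show ?thesis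
      using l by (simp add: maximal_coords_def)
  qed
  moreover have "\<beta> \<bullet> \<gamma> = 0" if \<beta>: "\<beta> \<in> R1" and \<gamma>: "\<gamma> \<in> R - R1" for \<beta> \<gamma>
  proof -
    obtain n where n: "\<beta> = comb n" "\<forall>\<alpha>\<in>S. n \<alpha> \<noteq> 0 \<longrightarrow> k \<alpha> \<noteq> 0"
      using \<beta> by (auto simp: R1_def)
    obtain j where j: "\<gamma> = comb j" "(\<forall>\<alpha>\<in>S. 0 \<le> j \<alpha>) \<or> (\<forall>\<alpha>\<in>S. j \<alpha> \<le> 0)"
      using \<gamma> root_coords by blast
    \<comment> \<open>Taking absolute values of the coordinates selects the positive one of \<open>\<gamma>\<close> and \<open>- \<gamma>\<close>.\<close>
    have "comb (\<lambda>\<alpha>. \<bar>j \<alpha>\<bar>) \<in> {comb j, - comb j}"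
      using j(2) unfolding int_comb_uminus[symmetric] insert_iff comb_eq_iff by auto
    then have "comb (\<lambda>\<alpha>. \<bar>j \<alpha>\<bar>) \<in> R"
      using \<gamma> j(1) uminus_root by auto
    then obtain h where h: "maximal_coords h" "\<forall>\<alpha>\<in>S. \<bar>j \<alpha>\<bar> \<le> h \<alpha>"
      using below_maximal_coords[of "\<lambda>\<alpha>. \<bar>j \<alpha>\<bar>"] by auto
    have "\<exists>\<alpha>\<in>S. k \<alpha> \<noteq> h \<alpha>"
    proof (rule ccontr)
      assume "\<not> (\<exists>\<alpha>\<in>S. k \<alpha> \<noteq> h \<alpha>)"
      then have "\<forall>\<alpha>\<in>S. j \<alpha> \<noteq> 0 \<longrightarrow> k \<alpha> \<noteq> 0"
        using h(2) by force
      then show False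
        using \<gamma> j(1) by (auto simp: R1_def)
    qed
    then have "of_int (j \<delta>) * (of_int (n \<alpha>) * (\<alpha> \<bullet> \<delta>)) = 0" if "\<alpha> \<in> S" "\<delta> \<in> S" for \<alpha> \<delta>
      using maximal_coords_supports_orthogonal[OF k h(1), of \<alpha> \<delta>] that n(2) h(2) by force
    then show ?thesis
      unfolding n(1) j(1) int_comb_inner_left int_comb_inner_right sum_distrib_left
      by (intro sum.neutral ballI)
  qed
  moreover have "R = R1 \<union> (R - R1)"
    by (auto simp: R1_def)
  ultimately have "R = R1 \<union> (R - R1) \<and> \<not> R1 \<subseteq> {0} \<and> \<not> R - R1 \<subseteq> {0} \<and>
      (\<forall>\<beta>\<in>R1. \<forall>\<gamma>\<in>R - R1. \<beta> \<bullet> \<gamma> = 0)"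
    using nonzero by (meson singletonD subsetD)
  then show False
    using assms(1) unfolding grs_irreducible_def by (metis (no_types))
qed

end

section \<open>Joins\<close>

text \<open>The join is the meet of the finite, nonempty set of upper bounds.\<close>

lemma (in lower_semilattice) is_lub_if_bounded:
  assumes "finite (carrier L)" "x \<in> carrier L" "y \<in> carrier L" "Upper L {x, y} \<noteq> {}"
  shows "\<exists>s. is_lub L s {x, y}"
proof -
  have U: "finite (Upper L {x, y})" "Upper L {x, y} \<subseteq> carrier L"
    using assms(1) by (auto intro: finite_subset)
  then have "is_glb L (\<Sqinter>(Upper L {x, y})) (Upper L {x, y})"
    using assms(4) finite_inf_greatest by blast
  then have "is_lub L (\<Sqinter>(Upper L {x, y})) {x, y}"
    using assms(2,3) unfolding greatest_def least_def Upper_def Lower_def by auto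
  then show ?thesis
    by blast
qed

lemma (in based_grs) irreducible_positive_poset_lattice:
  assumes "grs_irreducible R"
  shows "lattice (positive_poset R S)"
proof -
  interpret lower_semilattice "positive_poset R S"
    by (rule positive_poset_lower_semilattice)
  show ?thesis
  proof
    fix x y
    assume xy: "x \<in> carrier (positive_poset R S)" "y \<in> carrier (positive_poset R S)"
    then have "x \<in> positive_system R S" "y \<in> positive_system R S"
      by (simp_all add: positive_poset_def)
    then obtain k l where k: "x = comb k" "comb k \<in> R" "\<forall>\<alpha>\<in>S. 0 \<le> k \<alpha>"
      and l: "y = comb l" "comb l \<in> R" "\<forall>\<alpha>\<in>S. 0 \<le> l \<alpha>"
      using positive_system_coords by metis
    obtain h where h: "maximal_coords h" "\<forall>\<alpha>\<in>S. k \<alpha> \<le> h \<alpha>"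
      using below_maximal_coords k by blast
    obtain h' where h': "maximal_coords h'" "\<forall>\<alpha>\<in>S. l \<alpha> \<le> h' \<alpha>"
      using below_maximal_coords l by blast
    have "\<forall>\<alpha>\<in>S. l \<alpha> \<le> h \<alpha>"
      using irreducible_maximal_coords_unique[OF assms h(1) h'(1)] h'(2) by simp
    then have "grs_le S x (comb h)" "grs_le S y (comb h)"
      unfolding k(1) l(1) grs_le_comb_iff using h(2) by blast+
    moreover have "comb h \<in> positive_system R S"
      using h(1) by (simp add: comb_in_positive_system_iff maximal_coords_def)
    ultimately have "Upper (positive_poset R S) {x, y} \<noteq> {}"
      by (auto simp: Upper_def positive_poset_def)
    moreover have "finite (carrier (positive_poset R S))"
      using finite_R by (simp add: positive_poset_def positive_system_def)
    ultimately show "\<exists>s. is_lub (positive_poset R S) s {x, y}"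
      using is_lub_if_bounded xy by blast
  qed
qed

theorem proposition1p19:
  fixes R V S :: "'a::euclidean_space set"
  assumes "generalized_root_system R V"
    and "grs_base R V S"
  shows "lower_semilattice (positive_poset R S) \<and>
    (grs_irreducible R \<longrightarrow> lattice (positive_poset R S)) \<and>
    (\<forall>k' k''. int_comb S k' \<in> positive_system R S \<longrightarrow> int_comb S k'' \<in> positive_system R S \<longrightarrow>
       int_comb S k' \<sqinter>\<^bsub>positive_poset R S\<^esub> int_comb S k''
         = int_comb S (\<lambda>\<alpha>. min (k' \<alpha>) (k'' \<alpha>)))"
proof -
  interpret based_grs R V S
    using assms by unfold_locales
  show ?thesis
    using positive_poset_lower_semilattice irreducible_positive_poset_lattice meet_eq_coord_min
    by blast
qed

end
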